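(* Let $1\le p<\infty$ and $\omega\in\widehat{\mathcal D}$. Suppose $(\varphi_t)_{t\ge0}$ is a semigroup of analytic self-maps of $\mathbb D$ and $(C_t)_{t\ge0}$, $C_tf=f\circ\varphi_t$, is the corresponding composition semigroup on $A^p_\omega$. If there exists a $t_0$ such that $\|\varphi_{t_0}\|_{H^\infty}<1$, then $(C_t)_{t\ge0}$ is eventually norm continuous on $A^p_\omega$.
   Context: $\mathbb D=\{z\in\mathbb C:|z|<1\}$, $dA=\frac{dx\,dy}{\pi}$, $\|f\|_{H^\infty}=\sup_{z\in\mathbb D}|f(z)|$. A radial weight is a non-negative $\omega\in L^1(\mathbb D)$ with $\omega(z)=\omega(|z|)$. Put $\widehat\omega(z)=\int_{|z|}^1\omega(s)\,ds$; throughout, $\widehat\omega(z)>0$ for all $z\in\mathbb D$. A radial weight $\omega$ belongs to $\widehat{\mathcal D}$ if there is $C\ge1$ with $\widehat\omega(r)\le C\,\widehat\omega(\frac{1+r}{2})$ for all $0\le r<1$. $A^p_\omega$ consists of the analytic functions $f$ on $\mathbb D$ with $\|f\|_{A^p_\omega}^p=\int_{\mathbb D}|f|^p\omega\,dA<\infty$. A semigroup of analytic self-maps of $\mathbb D$ is a family $(\varphi_t)_{t\ge0}$ of analytic maps $\mathbb D\to\mathbb D$ with $\varphi_0=\mathrm{id}$, $\varphi_t\circ\varphi_s=\varphi_{t+s}$, and $\varphi_t(z)\to z$ as $t\to0^+$ for each $z\in\mathbb D$. $(C_t)$ is eventually norm continuous if there is $t_1>0$ such that $\lim_{s\to t}\|C_s-C_t\|=0$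 (operator norm on $A^p_\omega$) for all $t>t_1$. *)

theory Defs
  imports "HOL-Complex_Analysis.Complex_Analysis"
begin

abbreviation unit_disc :: "complex set" where
  "unit_disc \<equiv> ball 0 1"

text \<open>The measure \<open>dA = dx dy / \<pi>\<close> on the unit disc, with the Lebesgue measurable sets.\<close>

definition area_measure :: "complex measure" where
  "area_measure = scale_measure (ennreal (1 / pi)) (lebesgue_on unit_disc)"

text \<open>Weights and analytic functions are total functions on \<^typ>\<open>complex\<close>;
  only their values on the disc matter.\<close>

definition radial_weight :: "(complex \<Rightarrow> real) \<Rightarrow> bool" where
  "radial_weight \<omega> \<longleftrightarrow>
     (\<forall>z\<in>unit_disc. 0 \<le> \<omega> z) \<and>
     integrable area_measure \<omega> \<and>
     (\<forall>z\<in>unit_disc. \<omega> z = \<omega> (of_real (cmod z)))"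

text \<open>The value is extended because \<open>\<omega> \<in> L\<^sup>1\<close> controls only the integral of \<open>s \<omega>(s)\<close>,
  so the tail integral at the origin may be infinite.\<close>

definition tail_integral :: "(complex \<Rightarrow> real) \<Rightarrow> complex \<Rightarrow> ennreal" where
  "tail_integral \<omega> z = (\<integral>\<^sup>+s\<in>{cmod z..<1}. ennreal (\<omega> (of_real s)) \<partial>lebesgue)"

definition D_hat :: "(complex \<Rightarrow> real) set" where
  "D_hat = {\<omega>. radial_weight \<omega> \<and>
     (\<exists>C::real. C \<ge> 1 \<and> (\<forall>r::real. 0 \<le> r \<and> r < 1 \<longrightarrow>
        tail_integral \<omega> (of_real r) \<le> ennreal C * tail_integral \<omega> (of_real ((1 + r) / 2))))}"

definition bergman_integral :: "real \<Rightarrow> (complex \<Rightarrow> real) \<Rightarrow> (complex \<Rightarrow> complex) \<Rightarrow> ennreal" where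
  "bergman_integral p \<omega> f = (\<integral>\<^sup>+z. ennreal (cmod (f z) powr p * \<omega> z) \<partial>area_measure)"

definition bergman_space :: "real \<Rightarrow> (complex \<Rightarrow> real) \<Rightarrow> (complex \<Rightarrow> complex) set" where
  "bergman_space p \<omega> = {f. f holomorphic_on unit_disc \<and> bergman_integral p \<omega> f < \<infinity>}"

text \<open>The \<open>p\<close>-th root of the integral; it is infinite (not a default value) for functions
  that are not in the space.\<close>

definition bergman_norm :: "real \<Rightarrow> (complex \<Rightarrow> real) \<Rightarrow> (complex \<Rightarrow> complex) \<Rightarrow> ennreal" where
  "bergman_norm p \<omega> f =
     (if bergman_integral p \<omega> f = \<infinity> then \<infinity>
      else ennreal (enn2real (bergman_integral p \<omega> f) powr (1 / p)))"

text \<open>The space depends on the parameters \<open>p\<close> and \<open>\<omega>\<close>, hence is not a type, and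
  \<^const>\<open>onorm\<close> does not apply. The supremum is extended, so an unbounded operator
  has infinite norm.\<close>

definition bergman_opnorm ::
    "real \<Rightarrow> (complex \<Rightarrow> real) \<Rightarrow> ((complex \<Rightarrow> complex) \<Rightarrow> complex \<Rightarrow> complex) \<Rightarrow> ennreal" where
  "bergman_opnorm p \<omega> T =
     (SUP f\<in>{f \<in> bergman_space p \<omega>. bergman_norm p \<omega> f \<le> 1}. bergman_norm p \<omega> (T f))"

definition Hinf_norm :: "(complex \<Rightarrow> complex) \<Rightarrow> ennreal" where
  "Hinf_norm f = (SUP z\<in>unit_disc. ennreal (cmod (f z)))"

definition analytic_selfmap_semigroup :: "(real \<Rightarrow> complex \<Rightarrow> complex) \<Rightarrow> bool" where
  "analytic_selfmap_semigroup \<phi> \<longleftrightarrow>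
     (\<forall>t\<ge>0. \<phi> t holomorphic_on unit_disc \<and> \<phi> t ` unit_disc \<subseteq> unit_disc) \<and>
     (\<forall>z\<in>unit_disc. \<phi> 0 z = z) \<and>
     (\<forall>t\<ge>0. \<forall>s\<ge>0. \<forall>z\<in>unit_disc. \<phi> (t + s) z = \<phi> t (\<phi> s z)) \<and>
     (\<forall>z\<in>unit_disc. ((\<lambda>t. \<phi> t z) \<longlongrightarrow> z) (at_right 0))"

definition composition_semigroup ::
    "(real \<Rightarrow> complex \<Rightarrow> complex) \<Rightarrow> real \<Rightarrow> (complex \<Rightarrow> complex) \<Rightarrow> complex \<Rightarrow> complex" where
  "composition_semigroup \<phi> t f = f \<circ> \<phi> t"

definition eventually_norm_continuous ::
    "real \<Rightarrow> (complex \<Rightarrow> real) \<Rightarrow> (real \<Rightarrow> (complex \<Rightarrow> complex) \<Rightarrow> complex \<Rightarrow> complex) \<Rightarrow> bool" where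
  "eventually_norm_continuous p \<omega> T \<longleftrightarrow>
     (\<exists>t1>0. \<forall>t>t1.
        ((\<lambda>s. bergman_opnorm p \<omega> (\<lambda>f z. T s f z - T t f z)) \<longlongrightarrow> 0) (at t within {0..}))"

end

theory Submission
  imports Defs
begin

text \<open>If \<open>\<phi>\<^sub>t\<^sub>0\<close> maps the disc into \<open>|w| \<le> r < 1\<close>, then so does \<open>\<phi>\<^sub>s = \<phi>\<^sub>t\<^sub>0 \<circ> \<phi>\<^sub>s\<^sub>-\<^sub>t\<^sub>0\<close> for every
  \<open>s \<ge> t0\<close>. Functions in the unit ball of \<open>A\<^sup>p\<^sub>\<omega>\<close> are uniformly bounded on compact subsets of the
  disc, hence uniformly Lipschitz on \<open>|w| \<le> r\<close> with some constant \<open>L\<close>, so that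
  \<open>\<parallel>C\<^sub>s - C\<^sub>t\<parallel>\<^sup>p \<le> \<integral> (L |\<phi>\<^sub>s - \<phi>\<^sub>t|)\<^sup>p \<omega> dA\<close>, which tends to \<open>0\<close> by dominated convergence.

  The bound on compact sets averages Cauchy's formula over circles \<open>|u| = |z|\<close>, with \<open>z\<close> distributed
  according to \<open>\<omega> dA\<close> on an outer annulus; rotation invariance turns the double average into the
  Bergman integral. The annulus has positive mass because the tail integrals are positive.\<close>

lemma continuous_on_norm_powr:
  fixes f :: "'a::topological_space \<Rightarrow> 'b::real_normed_vector"
  assumes "continuous_on S f" "0 < p"
  shows "continuous_on S (\<lambda>x. norm (f x) powr p)"
  using assms by (intro continuous_on_powr' continuous_intros) auto

section \<open>Rotation invariance of planar Lebesgue measure\<close>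

lemma measurable_Complex [measurable]:
  "(\<lambda>(x, y). Complex x y) \<in> borel_measurable (lborel \<Otimes>\<^sub>M lborel)"
  unfolding lborel_prod split_beta' Complex_eq measurable_lborel2
  by (intro borel_measurable_continuous_onI continuous_intros)

text \<open>Lebesgue measure is determined by its values on boxes, and the preimage of a box is a
  box with the same side lengths. This opens the way to Fubini in Cartesian coordinates.\<close>

lemma distr_lborel_Complex:
  "distr (lborel \<Otimes>\<^sub>M lborel) borel (\<lambda>(x, y). Complex x y) = (lborel :: complex measure)"
proof (rule lborel_eqI[symmetric])
  fix l u :: complex
  assume lu: "\<And>b. b \<in> Basis \<Longrightarrow> l \<bullet> b \<le> u \<bullet> b"
  have le: "Re l \<le> Re u" "Im l \<le> Im u"
    using lu[of 1] lu[of \<i>] by (auto simp: Basis_complex_def inner_complex_def)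
  have vim: "(\<lambda>(x, y). Complex x y) -` box l u = box (Re l, Im l) (Re u, Im u)"
    by (auto simp: box_def Basis_complex_def Basis_prod_def inner_complex_def)
  show "emeasure (distr (lborel \<Otimes>\<^sub>M lborel) borel (\<lambda>(x, y). Complex x y)) (box l u)
      = ennreal (\<Prod>b\<in>Basis. (u - l) \<bullet> b)"
    using le measurable_Complex by (subst emeasure_distr)
      (auto simp: vim lborel_prod space_pair_measure emeasure_lborel_box_eq Basis_prod_def
        Basis_complex_def inner_complex_def inner_diff_left prod.union_disjoint)
qed simp

text \<open>Both orders of integration serve below: a horizontal shear is a translation for fixed
  imaginary part, a vertical one for fixed real part.\<close>

lemma nn_integral_lborel_complex:
  assumes [measurable]: "f \<in> borel_measurable (borel :: complex measure)"
  shows "(\<integral>\<^sup>+z. f z \<partial>lborel) = (\<integral>\<^sup>+y. \<integral>\<^sup>+x. f (Complex x y) \<partial>lborel \<partial>lborel)"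
    and "(\<integral>\<^sup>+z. f z \<partial>lborel) = (\<integral>\<^sup>+x. \<integral>\<^sup>+y. f (Complex x y) \<partial>lborel \<partial>lborel)"
proof -
  have "(\<integral>\<^sup>+z. f z \<partial>lborel) = (\<integral>\<^sup>+p. f (Complex (fst p) (snd p)) \<partial>(lborel \<Otimes>\<^sub>M lborel))"
    by (subst distr_lborel_Complex[symmetric], subst nn_integral_distr) (auto simp: split_beta')
  moreover have "(\<lambda>(x, y). f (Complex x y)) \<in> borel_measurable (lborel \<Otimes>\<^sub>M lborel)"
    using measurable_compose[OF measurable_Complex assms] by (simp add: split_beta')
  ultimately show "(\<integral>\<^sup>+z. f z \<partial>lborel) = (\<integral>\<^sup>+y. \<integral>\<^sup>+x. f (Complex x y) \<partial>lborel \<partial>lborel)"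
    and "(\<integral>\<^sup>+z. f z \<partial>lborel) = (\<integral>\<^sup>+x. \<integral>\<^sup>+y. f (Complex x y) \<partial>lborel \<partial>lborel)"
    using lborel_pair.nn_integral_snd[of "\<lambda>p. f (Complex (fst p) (snd p))"]
      lborel.nn_integral_fst[of "\<lambda>p. f (Complex (fst p) (snd p))" lborel]
    by (simp_all add: split_beta')
qed

lemma nn_integral_real_translate:
  assumes [measurable]: "f \<in> borel_measurable (borel :: real measure)"
  shows "(\<integral>\<^sup>+x. f (x + a) \<partial>lborel) = (\<integral>\<^sup>+x. f x \<partial>lborel)"
  using nn_integral_real_affine[of f 1 a] by (simp add: add.commute)

lemma nn_integral_shear_Re:
  assumes [measurable]: "f \<in> borel_measurable (borel :: complex measure)"
  shows "(\<integral>\<^sup>+z. f (z + of_real (a * Im z)) \<partial>lborel) = (\<integral>\<^sup>+z. f z \<partial>lborel)"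
proof -
  have "(\<lambda>x. f (Complex x y)) \<in> borel_measurable borel" for y
    by (simp add: Complex_eq)
  moreover have "Complex x y + of_real (a * y) = Complex (x + a * y) y" for x y
    by (simp add: complex_eq_iff)
  ultimately show ?thesis
    using nn_integral_real_translate[of "\<lambda>x. f (Complex x y)" "a * y" for y]
    by (simp add: nn_integral_lborel_complex(1) del: of_real_mult)
qed

lemma nn_integral_shear_Im:
  assumes [measurable]: "f \<in> borel_measurable (borel :: complex measure)"
  shows "(\<integral>\<^sup>+z. f (z + \<i> * of_real (a * Re z)) \<partial>lborel) = (\<integral>\<^sup>+z. f z \<partial>lborel)"
proof -
  have "(\<lambda>y. f (Complex x y)) \<in> borel_measurable borel" for x
    by (simp add: Complex_eq)
  moreover have "Complex x y + \<i> * of_real (a * x) = Complex x (y + a * x)" for x y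
    by (simp add: complex_eq_iff)
  ultimately show ?thesis
    using nn_integral_real_translate[of "\<lambda>y. f (Complex x y)" "a * x" for x]
    by (simp add: nn_integral_lborel_complex(2) del: of_real_mult)
qed

text \<open>A rotation other than \<open>\<plusminus> id\<close> is a product of three shears.\<close>

lemma nn_integral_lborel_rotate:
  assumes f: "f \<in> borel_measurable (borel :: complex measure)" and c: "cmod c = 1"
  shows "(\<integral>\<^sup>+z. f (c * z) \<partial>lborel) = (\<integral>\<^sup>+z. f z \<partial>lborel)"
proof -
  have rot: "(\<integral>\<^sup>+z. f (c * z) \<partial>lborel) = (\<integral>\<^sup>+z. f z \<partial>lborel)"
    if c: "cmod c = 1" "Im c \<noteq> 0" and f[measurable]: "f \<in> borel_measurable borel"
    for c and f :: "complex \<Rightarrow> ennreal"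
  proof -
    \<comment> \<open>For \<open>c = cos \<theta> + \<i> sin \<theta>\<close> these are
      \<open>a = - tan (\<theta> / 2)\<close> and \<open>b = sin \<theta>\<close>. The rotation is
      the horizontal shear by \<open>a\<close>, then the vertical one by \<open>b\<close>, then the
      horizontal one by \<open>a\<close> again.\<close>
    define a where "a = (Re c - 1) / Im c"
    define b where "b = Im c"
    define S where "S = (\<lambda>z. z + of_real (a * Im z))"
    define T where "T = (\<lambda>z. z + \<i> * of_real (b * Re z))"
    have meas[measurable]: "S \<in> borel_measurable borel" "T \<in> borel_measurable borel"
      by (auto simp: S_def T_def intro!: borel_measurable_continuous_onI continuous_intros)
    have sq: "Re c * Re c + Im c * Im c = 1"
      using c(1) by (metis cmod_power2 one_power2 power2_eq_square)
    have ab: "a * b = Re c - 1" and "a * (Re c + 1) = - b"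
      using c(2) sq by (auto simp: a_def b_def field_simps)
    then have aa: "a * Re c = - b - a"
      by (simp add: algebra_simps)
    have "c * z = S (T (S z))" for z
    proof -
      define x y where "x = Re z" and "y = Im z"
      have "Re (S (T (S z))) = x + a * y + a * y + (a * b) * (x + a * y)"
        by (simp add: S_def T_def x_def y_def algebra_simps)
      also have "\<dots> = Re c * x + (a * Re c + a) * y"
        by (simp add: ab algebra_simps)
      finally have "Re (S (T (S z))) = Re c * x - Im c * y"
        by (simp add: aa b_def)
      moreover have "Im (S (T (S z))) = y + b * x + (a * b) * y"
        by (simp add: S_def T_def x_def y_def algebra_simps)
      then have "Im (S (T (S z))) = Re c * y + Im c * x"
        by (simp add: ab, simp add: b_def algebra_simps)
      ultimately show ?thesis
        by (simp add: complex_eq_iff x_def y_def)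
    qed
    then have "(\<integral>\<^sup>+z. f (c * z) \<partial>lborel) = (\<integral>\<^sup>+z. (f \<circ> S \<circ> T) (S z) \<partial>lborel)"
      by simp
    also have "\<dots> = (\<integral>\<^sup>+z. (f \<circ> S) (T z) \<partial>lborel)"
      unfolding S_def by (subst nn_integral_shear_Re) (simp_all add: comp_def flip: S_def)
    also have "\<dots> = (\<integral>\<^sup>+z. f (S z) \<partial>lborel)"
      unfolding T_def by (subst nn_integral_shear_Im) (simp_all add: comp_def)
    also have "\<dots> = (\<integral>\<^sup>+z. f z \<partial>lborel)"
      unfolding S_def by (subst nn_integral_shear_Re) auto
    finally show ?thesis .
  qed
  show ?thesis
  proof (cases "Im c = 0")
    case False
    then show ?thesis using rot c f by blast
  next
    case True
    then have "\<bar>Re c\<bar> = 1" using c by (simp add: cmod_def)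
    then consider "c = 1" | "c = -1" using True by (auto simp: complex_eq_iff abs_if split: if_splits)
    then show ?thesis
    proof cases
      \<comment> \<open>The half turn has \<open>Im c = 0\<close>, but it is the quarter turn by
        \<open>\<i>\<close> applied twice.\<close>
      case 2
      have "(\<lambda>z. f (\<i> * z)) \<in> borel_measurable borel" using f by measurable
      then show ?thesis
        using rot[of \<i> "\<lambda>z. f (\<i> * z)"] rot[of \<i> f] f 2 by (simp flip: mult.assoc)
    qed simp
  qed
qed

section \<open>Positive tail integrals and the mass of outer annuli\<close>

text \<open>The smooth map \<open>z \<mapsto> (Im z, |z|)\<close> sends the null set where the weight does not vanish to a set
  that contains \<open>[0, \<rho>] \<times> E\<close>, where \<open>E\<close> is the set of radii at which the weight does not vanish;
  by Fubini \<open>E\<close> is null. This replaces polar coordinates.\<close>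

lemma radial_null_imp_tail_zero:
  fixes \<omega> :: "complex \<Rightarrow> real"
  assumes radial: "\<forall>z\<in>unit_disc. \<omega> z = \<omega> (of_real (cmod z))"
    and \<rho>: "0 < \<rho>"
    and null: "AE z in lborel. \<rho> \<le> cmod z \<and> cmod z < 1 \<longrightarrow> \<omega> z = 0"
  shows "tail_integral \<omega> (of_real \<rho>) = 0"
proof -
  define N where "N = {z. \<rho> \<le> cmod z \<and> cmod z < 1 \<and> \<omega> z \<noteq> 0}"
  define h where "h = (\<lambda>z. (Im z, cmod z))"
  obtain N' where "N \<subseteq> N'" "N' \<in> null_sets lborel"
    using null unfolding eventually_ae_filter N_def by auto
  then have "negligible N"
    by (metis negligible_iff_null_sets negligible_subset null_sets_completionI)
  moreover have "h differentiable_on N"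
  proof -
    have "h differentiable (at z)" if "z \<in> N" for z
    proof -
      \<comment> \<open>The modulus is differentiable away from the origin, and \<open>N\<close>
        keeps distance at least \<open>\<rho>\<close> from it.\<close>
      from that \<rho> have "z \<noteq> 0" by (auto simp: N_def)
      then obtain D where "(cmod has_derivative D) (at z)"
        using differentiable_norm_at by (auto simp: differentiable_def)
      then have "(h has_derivative (\<lambda>x. (Im x, D x))) (at z)"
        unfolding h_def by (intro has_derivative_Pair bounded_linear_imp_has_derivative bounded_linear_Im)
      then show ?thesis by (rule differentiableI)
    qed
    then show ?thesis by (rule differentiable_at_imp_differentiable_on)
  qed
  ultimately have "negligible (h ` N)"
    by (intro negligible_differentiable_image_negligible) auto
  then have "AE q in lborel. q \<notin> h ` N"
    by (metis AE_completion_iff AE_not_in negligible_iff_null_sets)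
  then have "AE y in lborel. AE s in lborel. (y, s) \<notin> h ` N"
    unfolding lborel_prod[symmetric] by (rule lborel_pair.AE_pair)
  then obtain y where y: "0 \<le> y" "y \<le> \<rho>" "AE s in lborel. (y, s) \<notin> h ` N"
  proof -
    assume *: "AE y in lborel. AE s in lborel. (y, s) \<notin> h ` N"
    \<comment> \<open>The interval has positive length, so an exceptional null set cannot cover it.
      A single good height \<open>y\<close> suffices for all radii.\<close>
    have "\<exists>y\<in>{0..\<rho>}. AE s in lborel. (y, s) \<notin> h ` N"
    proof (rule ccontr)
      assume "\<not> ?thesis"
      with * have "AE y in lborel. y \<notin> {0..\<rho>}" by (auto elim!: eventually_mono)
      then have "{0..\<rho>} \<in> null_sets lborel" by (simp add: AE_iff_null_sets)
      then show False using \<rho> by (auto simp: null_sets_def)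
    qed
    then show ?thesis using that by auto
  qed
  have "\<omega> (of_real s) = 0" if s: "\<rho> \<le> s" "s < 1" "(y, s) \<notin> h ` N" for s
  proof (rule ccontr)
    assume nz: "\<omega> (of_real s) \<noteq> 0"
    \<comment> \<open>This is a point at height \<open>y\<close> on the circle of radius
      \<open>s\<close>; it exists because \<open>y \<le> \<rho> \<le> s\<close>. By radiality the
      weight has the same value there as at \<open>s\<close>.\<close>
    define z where "z = Complex (sqrt (s\<^sup>2 - y\<^sup>2)) y"
    have "y\<^sup>2 \<le> s\<^sup>2" using y s by (intro power_mono) auto
    then have cz: "cmod z = s" using s \<rho> by (simp add: z_def cmod_def)
    then have "z \<in> N" using nz s radial by (auto simp: N_def)
    moreover have "(y, s) = h z"
      unfolding h_def cz by (simp add: z_def)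
    ultimately have "(y, s) \<in> h ` N" by blast
    then show False using s by simp
  qed
  with y(3) have "AE s in lborel. ennreal (\<omega> (of_real s)) * indicator {\<rho>..<1} s = 0"
    by (auto elim!: eventually_mono simp: indicator_def)
  then have "(\<integral>\<^sup>+s. ennreal (\<omega> (of_real s)) * indicator {\<rho>..<1} s \<partial>lborel) = 0"
    by (subst nn_integral_cong_AE[where v = "\<lambda>_. 0"]) auto
  then show ?thesis
    using \<rho> by (simp add: tail_integral_def nn_integral_completion)
qed

section \<open>Cauchy estimates\<close>

text \<open>Cauchy's inequality on discs of radius \<open>(R - r) / 2\<close> bounds the derivative
  on the closed disc of radius \<open>r\<close>, which is convex. Half the gap keeps these closed
  discs inside the open one.\<close>

lemma holomorphic_bounded_lipschitz:
  assumes f: "f holomorphic_on ball 0 R" and B: "\<And>z. z \<in> ball 0 R \<Longrightarrow> cmod (f z) \<le> B"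
    and r: "r < R" and ab: "cmod a \<le> r" "cmod b \<le> r"
  shows "cmod (f a - f b) \<le> B / ((R - r) / 2) * cmod (a - b)"
proof (rule field_differentiable_bound[where S = "cball 0 r" and f' = "deriv f"])
  fix z :: complex assume z: "z \<in> cball 0 r"
  then have "z \<in> ball 0 R" using r by auto
  then show "(f has_field_derivative deriv f z) (at z within cball 0 r)"
    using f by (meson DERIV_subset holomorphic_derivI open_ball subset_UNIV)
  define d where "d = (R - r) / 2"
  have sub: "cball z d \<subseteq> ball 0 R"
  proof
    fix x assume "x \<in> cball z d"
    moreover have "cmod x \<le> cmod z + dist z x"
      by (metis dist_norm norm_minus_commute norm_triangle_sub)
    moreover have "r + d < R" using r by (simp add: d_def field_simps)
    ultimately show "x \<in> ball 0 R" using z by auto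
  qed
  have hol: "f holomorphic_on cball z d" using f sub by (rule holomorphic_on_subset)
  have "cmod ((deriv ^^ 1) f z) \<le> fact 1 * B / d ^ 1"
  proof (rule Cauchy_inequality)
    show "f holomorphic_on ball z d" using hol ball_subset_cball by (rule holomorphic_on_subset)
    show "continuous_on (cball z d) f" using hol by (rule holomorphic_on_imp_continuous_on)
    show "0 < d" using r by (simp add: d_def)
    show "\<And>x. cmod (z - x) = d \<Longrightarrow> cmod (f x) \<le> B"
      using sub B by (auto simp: dist_norm subset_iff)
  qed
  then show "cmod (deriv f z) \<le> B / ((R - r) / 2)" by (simp add: d_def)
qed (use ab in auto)

text \<open>The estimate \<open>a \<le> 1 + a\<^sup>p\<close> takes the place of Jensen's inequality, since only the unit ball of
  the Bergman space matters.\<close>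

lemma norm_Cauchy_circle_le:
  assumes f: "f holomorphic_on unit_disc" and r: "0 \<le> r" "r < \<rho>" "\<rho> \<le> cmod z" "cmod z < 1"
    and w: "cmod w \<le> r" and p: "1 \<le> p"
  shows "ennreal (cmod (f w)) \<le> ennreal (\<rho> / (\<rho> - r)) *
    (\<integral>\<^sup>+x\<in>{0..1}. ennreal (1 + cmod (f (exp (2 * of_real pi * \<i> * of_real x) * z)) powr p) \<partial>lborel)"
proof -
  \<comment> \<open>Rescaling by \<open>z\<close> turns the circle \<open>|u| = |z|\<close> into the
    unit circle and \<open>w\<close> into \<open>w / z\<close>, a point of modulus at most
    \<open>r / \<rho> < 1\<close>.\<close>
  define g where "g = (\<lambda>u. f (u * z))"
  define e where "e = (\<lambda>x::real. exp (2 * of_real pi * \<i> * of_real x))"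
  define H where "H = (\<lambda>x. 1 + cmod (f (e x * z)) powr p)"
  \<comment> \<open>This equals \<open>1 / (1 - r / \<rho>)\<close>, the reciprocal of a lower bound
    for the distance from \<open>w / z\<close> to the unit circle.\<close>
  define Q where "Q = \<rho> / (\<rho> - r)"
  have z0: "z \<noteq> 0" using r by auto
  have ne: "cmod (e x) = 1" for x by (simp add: e_def)
  have sub: "(\<lambda>u. u * z) ` cball 0 1 \<subseteq> unit_disc"
  proof clarsimp
    fix u assume "cmod u \<le> 1"
    then have "cmod u * cmod z \<le> 1 * cmod z" by (intro mult_right_mono) auto
    then show "cmod (u * z) < 1" using r by (simp add: norm_mult)
  qed
  have "g holomorphic_on cball 0 1"
    unfolding g_def
    by (rule holomorphic_on_compose_gen[OF _ f sub, unfolded comp_def]) (intro holomorphic_intros)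
  moreover have wz: "cmod (w / z) \<le> r / \<rho>"
    using r w by (simp add: norm_divide frac_le)
  have r1: "r / \<rho> < 1" using r by simp
  with wz have "cmod (w / z - 0) < 1" by simp
  ultimately have "((\<lambda>u. g u / (u - w / z)) has_contour_integral 2 * of_real pi * \<i> * g (w / z)) (circlepath 0 1)"
    by (intro Cauchy_integral_circlepath_simple)
  moreover have "circlepath 0 1 = e" "vector_derivative (circlepath 0 1) (at x) = 2 * pi * \<i> * e x" for x
    unfolding vector_derivative_circlepath by (simp_all add: circlepath e_def fun_eq_iff)
  ultimately have int: "((\<lambda>x. g (e x) / (e x - w / z) * (2 * pi * \<i> * e x)) has_integral 2 * of_real pi * \<i> * f w) {0..1}"
    using z0 unfolding has_contour_integral by (simp add: g_def)
  have cH: "continuous_on {0..1} H"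
  proof -
    have "continuous_on {0..1} (\<lambda>x. e x * z)" unfolding e_def by (intro continuous_intros)
    moreover have "(\<lambda>x. e x * z) ` {0..1} \<subseteq> unit_disc" using ne r by (auto simp: norm_mult)
    ultimately have "continuous_on {0..1} (\<lambda>x. f (e x * z))"
      using holomorphic_on_imp_continuous_on[OF f] continuous_on_compose2 by blast
    then show ?thesis unfolding H_def using p by (intro continuous_intros continuous_on_norm_powr) auto
  qed
  then have iH: "H integrable_on {0..1}" by (rule integrable_continuous_interval)
  have Hn: "0 \<le> H x" for x by (simp add: H_def)
  have bound: "cmod (g (e x) / (e x - w / z) * (2 * pi * \<i> * e x)) \<le> 2 * pi * Q * H x" for x
  proof -
    have "1 - r / \<rho> \<le> cmod (e x) - cmod (w / z)" using wz ne by simp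
    also have "\<dots> \<le> cmod (e x - w / z)" by (rule norm_triangle_ineq2)
    finally have *: "1 - r / \<rho> \<le> cmod (e x - w / z)" .
    have "a \<le> 1 + a powr p" if "0 \<le> a" for a
    proof (cases "a \<le> 1")
      case False
      then have "a powr 1 \<le> a powr p" using p by (intro powr_mono) auto
      then show ?thesis using False by simp
    qed (simp add: add_increasing2)
    then have "cmod (g (e x)) \<le> H x" by (simp add: H_def g_def)
    then have "cmod (g (e x)) / cmod (e x - w / z) \<le> H x / (1 - r / \<rho>)"
      using * r1 Hn by (intro frac_le) auto
    also have "\<dots> = Q * H x" using r by (simp add: Q_def field_simps)
    finally have "2 * pi * (cmod (g (e x)) / cmod (e x - w / z)) \<le> 2 * pi * (Q * H x)"
      by (intro mult_left_mono) auto
    then show ?thesis using ne by (simp add: norm_mult norm_divide mult_ac)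
  qed
  have "2 * pi * cmod (f w) = cmod (2 * of_real pi * \<i> * f w)" by (simp add: norm_mult)
  also have "\<dots> \<le> integral {0..1} (\<lambda>x. 2 * pi * Q * H x)"
    unfolding integral_unique[OF int, symmetric]
    using has_integral_integrable[OF int] integrable_on_cmult_left[OF iH] bound
    by (intro integral_norm_bound_integral) auto
  also have "\<dots> = 2 * pi * (Q * integral {0..1} H)" by simp
  finally have "cmod (f w) \<le> Q * integral {0..1} H" by simp
  moreover have "(\<integral>\<^sup>+x\<in>{0..1}. ennreal (H x) \<partial>lborel) = ennreal (integral {0..1} H)"
    using nn_integral_has_integral_lebesgue'[OF Hn integrable_integral[OF iH]] .
  moreover have "0 \<le> Q" using r by (simp add: Q_def)
  ultimately show ?thesis
    by (simp add: Q_def H_def e_def ennreal_mult'[symmetric] ennreal_leI)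
qed

section \<open>Measurability and integration with respect to \<open>area_measure\<close>\<close>

lemma space_area_measure [simp]: "space area_measure = unit_disc"
  by (simp add: area_measure_def space_scale_measure)

lemma sets_area_measure [measurable_cong]: "sets area_measure = sets (lebesgue_on unit_disc)"
  by (simp add: area_measure_def)

lemma borel_measurable_area_measure:
  "borel_measurable area_measure = borel_measurable (lebesgue_on unit_disc)"
  by (intro measurable_cong_sets sets_area_measure refl)

lemma nn_integral_area_measure:
  assumes "F \<in> borel_measurable area_measure"
  shows "(\<integral>\<^sup>+z. F z \<partial>area_measure) = ennreal (1 / pi) * (\<integral>\<^sup>+z\<in>unit_disc. F z \<partial>lborel)"
  using assms unfolding borel_measurable_area_measure
  by (simp add: area_measure_def nn_integral_scale_measure nn_integral_restrict_space nn_integral_completion)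

lemma continuous_on_borel_measurable_area:
  "continuous_on unit_disc f \<Longrightarrow> f \<in> borel_measurable area_measure"
  unfolding borel_measurable_area_measure by (rule continuous_imp_measurable_on_sets_lebesgue) auto

lemma lebesgue_measurable_of_area:
  fixes f :: "complex \<Rightarrow> real"
  assumes "f \<in> borel_measurable area_measure"
  shows "(\<lambda>z. ennreal (f z) * indicator unit_disc z) \<in> borel_measurable lebesgue"
proof -
  have "(\<lambda>z. if z \<in> unit_disc then f z else 0) \<in> borel_measurable lebesgue"
    using assms unfolding borel_measurable_area_measure by (rule borel_measurable_if_I) auto
  then have "(\<lambda>z. ennreal (if z \<in> unit_disc then f z else 0)) \<in> borel_measurable lebesgue"
    by measurable
  also have "(\<lambda>z. ennreal (if z \<in> unit_disc then f z else 0)) = (\<lambda>z. ennreal (f z) * indicator unit_disc z)"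
    by (auto simp: fun_eq_iff indicator_def)
  finally show ?thesis .
qed

text \<open>Rotation invariance is applied to the indicator of a Borel null set containing the
  exceptional points.\<close>

lemma AE_lborel_rotate:
  assumes c: "cmod c = 1" and P: "AE z in lborel. P z"
  shows "AE z in lborel. P (c * z)"
proof -
  obtain N where N: "{z. \<not> P z} \<subseteq> N" "N \<in> null_sets lborel"
    using P unfolding eventually_ae_filter by auto
  then have [measurable]: "N \<in> sets borel" by auto
  have "(\<integral>\<^sup>+z. indicator N (c * z) \<partial>lborel) = (\<integral>\<^sup>+z. indicator N z \<partial>lborel)"
    using c by (intro nn_integral_lborel_rotate) auto
  also have "\<dots> = 0" using N by auto
  finally have "AE z in lborel. indicator N (c * z) = (0 :: ennreal)"
    by (subst (asm) nn_integral_0_iff_AE) auto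
  then show ?thesis
    using N(1) by (auto elim!: eventually_mono simp: indicator_def split: if_splits)
qed

section \<open>Uniform bounds on compact sets for the unit ball of the Bergman space\<close>

lemma bergman_point_bound:
  assumes p: "1 \<le> p" and \<omega>: "radial_weight \<omega>"
    and pos: "\<forall>z\<in>unit_disc. 0 < tail_integral \<omega> z" and r: "0 \<le> r" "r < 1"
  obtains K where "0 \<le> K"
    "\<And>f w. f holomorphic_on unit_disc \<Longrightarrow> bergman_integral p \<omega> f \<le> 1 \<Longrightarrow> cmod w \<le> r \<Longrightarrow> cmod (f w) \<le> K"
proof -
  \<comment> \<open>Any radius strictly between \<open>r\<close> and \<open>1\<close> would do: the
    annulus \<open>\<rho> \<le> |z| < 1\<close> stays away from the points \<open>w\<close> and has
    positive mass.\<close>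
  define \<rho> where "\<rho> = (1 + r) / 2"
  have \<rho>: "0 < \<rho>" "r < \<rho>" "\<rho> < 1" using r by (auto simp: \<rho>_def)
  have radial: "\<forall>z\<in>unit_disc. \<omega> z = \<omega> (of_real (cmod z))"
    using \<omega> unfolding radial_weight_def by blast
  have nonneg: "0 \<le> \<omega> z" if "cmod z < 1" for z
    using \<omega>[unfolded radial_weight_def, THEN conjunct1] that by simp
  have int: "integrable area_measure \<omega>" using \<omega> unfolding radial_weight_def by blast
  define W' where "W' = (\<integral>\<^sup>+z\<in>unit_disc. ennreal (\<omega> z) \<partial>lborel)"
  have "(\<integral>\<^sup>+z. ennreal (norm (\<omega> z)) \<partial>area_measure) < \<infinity>"
    using int by (simp add: integrable_iff_bounded)
  also have "(\<integral>\<^sup>+z. ennreal (norm (\<omega> z)) \<partial>area_measure) = (\<integral>\<^sup>+z. ennreal (\<omega> z) \<partial>area_measure)"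
    using nonneg by (intro nn_integral_cong) simp
  also have "\<dots> = ennreal (1 / pi) * W'"
    using borel_measurable_integrable[OF int] by (simp add: W'_def nn_integral_area_measure)
  finally have W'_fin: "W' < \<infinity>"
    by (auto simp: ennreal_mult_less_top)
  define G where "G = (\<lambda>z. ennreal (\<omega> z) * indicator (unit_disc - ball 0 \<rho>) z)"
  have "(\<lambda>z. ennreal (\<omega> z) * indicator unit_disc z * indicator (- ball 0 \<rho>) z) \<in> borel_measurable lebesgue"
    by (intro borel_measurable_times_ennreal borel_measurable_indicator lebesgue_measurable_of_area
        borel_measurable_integrable[OF int]) auto
  also have "(\<lambda>z. ennreal (\<omega> z) * indicator unit_disc z * indicator (- ball 0 \<rho>) z) = G"
    by (auto simp: G_def fun_eq_iff indicator_def)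
  \<comment> \<open>\<open>G\<close> is only Lebesgue measurable. Its Borel version \<open>g\<close>
    gives a measure on the Borel sets, to which Fubini and the rotation lemma apply.\<close>
  finally obtain g where g[measurable]: "g \<in> borel_measurable lborel" and Gg: "AE z in lborel. G z = g z"
    using completion_ex_borel_measurable by blast
  have g'[measurable]: "g \<in> borel_measurable borel" using g by simp
  define \<mu> where "\<mu> = density lborel g"
  have [measurable_cong]: "sets \<mu> = sets borel" by (simp add: \<mu>_def)
  have space\<mu>: "space \<mu> = UNIV" by (simp add: \<mu>_def)
  have nn_\<mu>: "(\<integral>\<^sup>+z. h z \<partial>\<mu>) = (\<integral>\<^sup>+z. G z * h z \<partial>lborel)" if "h \<in> borel_measurable borel" for h
    unfolding \<mu>_def using that Gg by (subst nn_integral_density) (auto intro!: nn_integral_cong_AE)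
  define W where "W = (\<integral>\<^sup>+z. G z \<partial>lborel)"
  have "W \<le> W'" unfolding W_def W'_def G_def by (intro nn_integral_mono) (auto simp: indicator_def)
  then have W_fin: "W < \<infinity>" using W'_fin by order
  have em: "emeasure \<mu> UNIV = W"
    using nn_integral_cong_AE[OF Gg] by (simp add: \<mu>_def emeasure_density W_def)
  have W_pos: "0 < W"
  proof (rule ccontr)
    assume "\<not> 0 < W"
    then have "(\<integral>\<^sup>+z. g z \<partial>lborel) = 0"
      using Gg nn_integral_cong_AE[of G g lborel] by (simp add: W_def)
    then have "AE z in lborel. g z = 0" by (subst (asm) nn_integral_0_iff_AE) auto
    with Gg have "AE z in lborel. G z = 0" by auto
    then have "AE z in lborel. \<rho> \<le> cmod z \<and> cmod z < 1 \<longrightarrow> \<omega> z = 0"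
      using nonneg by (auto elim!: eventually_mono simp: G_def indicator_def ennreal_eq_0_iff dest: antisym)
    then have "tail_integral \<omega> (of_real \<rho>) = 0"
      by (rule radial_null_imp_tail_zero[OF radial \<rho>(1)])
    moreover have "of_real \<rho> \<in> unit_disc" using \<rho> by simp
    ultimately show False using pos by fastforce
  qed
  interpret \<mu>: finite_measure \<mu>
    using em W_fin by (intro finite_measureI) (simp add: \<mu>_def)
  interpret pair_sigma_finite lborel \<mu> ..
  have rot: "(\<integral>\<^sup>+z. h (c * z) \<partial>\<mu>) = (\<integral>\<^sup>+z. h z \<partial>\<mu>)"
    if c: "cmod c = 1" and h[measurable]: "h \<in> borel_measurable borel" for c h
  proof -
    have "\<omega> (c * z) = \<omega> z" if "z \<in> unit_disc" for z
    proof -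
      have "cmod (c * z) = cmod z" using c by (simp add: norm_mult)
      moreover from this that have "c * z \<in> unit_disc" by simp
      ultimately show ?thesis using radial that by metis
    qed
    then have "G (c * z) = G z" for z
      using c by (simp add: G_def indicator_def norm_mult)
    \<comment> \<open>\<open>G\<close> is invariant at every point, but \<open>g\<close> agrees with
      it only almost everywhere; the agreement is used at both \<open>z\<close> and
      \<open>c * z\<close>.\<close>
    then have "AE z in lborel. g z = g (c * z)"
      using Gg AE_lborel_rotate[OF c Gg] by auto
    then have "(\<integral>\<^sup>+z. h (c * z) \<partial>\<mu>) = (\<integral>\<^sup>+z. g (c * z) * h (c * z) \<partial>lborel)"
      unfolding \<mu>_def by (subst nn_integral_density) (auto intro!: nn_integral_cong_AE)
    also have "\<dots> = (\<integral>\<^sup>+z. g z * h z \<partial>lborel)"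
      using c by (intro nn_integral_lborel_rotate) auto
    finally show ?thesis unfolding \<mu>_def by (simp add: nn_integral_density)
  qed
  define Q where "Q = \<rho> / (\<rho> - r)"
  have Q: "0 \<le> Q" using \<rho> by (simp add: Q_def)
  define e where "e = (\<lambda>x::real. exp (2 * of_real pi * \<i> * of_real x))"
  have [measurable]: "e \<in> borel_measurable borel"
    unfolding e_def by (intro borel_measurable_continuous_onI continuous_intros)
  \<comment> \<open>The averaged estimate reads \<open>|f w| * W \<le> Q * (W' + pi)\<close>, with
    \<open>W\<close> and \<open>W'\<close> the masses of the annulus and of the disc without the
    factor \<open>1 / pi\<close>. The term \<open>W'\<close> comes from the \<open>1\<close> in
    \<open>1 + |f|^p\<close>, and \<open>pi\<close> undoes the normalisation in the Bergman
    integral.\<close>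
  define K where "K = Q * (enn2real W' + pi) / enn2real W"
  show thesis
  proof (rule that[of K])
    show "0 \<le> K" using Q by (simp add: K_def)
    fix f w assume f: "f holomorphic_on unit_disc" and If: "bergman_integral p \<omega> f \<le> 1" and w: "cmod w \<le> r"
    define h where "h = (\<lambda>z. ennreal (indicator unit_disc z *\<^sub>R (1 + cmod (f z) powr p)))"
    have "continuous_on unit_disc (\<lambda>z. 1 + cmod (f z) powr p)"
      using p holomorphic_on_imp_continuous_on[OF f] by (intro continuous_intros continuous_on_norm_powr) auto
    then have h[measurable]: "h \<in> borel_measurable borel"
      unfolding h_def by (intro measurable_compose[OF _ measurable_ennreal] borel_measurable_continuous_on_indicator) auto
    have f\<omega>: "(\<lambda>z. cmod (f z) powr p * \<omega> z) \<in> borel_measurable area_measure"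
      using holomorphic_on_imp_continuous_on[OF f] p
      by (intro borel_measurable_times borel_measurable_integrable[OF int]
          continuous_on_borel_measurable_area continuous_on_norm_powr) auto
    \<comment> \<open>The density vanishes almost everywhere off the annulus, so the circle estimate
      is required only for \<open>z\<close> in it.\<close>
    have "AE z in \<mu>. ennreal (cmod (f w)) \<le> ennreal Q * (\<integral>\<^sup>+x\<in>{0..1}. h (e x * z) \<partial>lborel)"
      unfolding \<mu>_def AE_density[OF g]
      using Gg
    proof eventually_elim
      case (elim z)
      show ?case
      proof
        assume "0 < g z"
        with elim have "0 < G z" by simp
        then have z: "\<rho> \<le> cmod z" "cmod z < 1"
          by (cases "z \<in> unit_disc - ball 0 \<rho>"; simp add: G_def)+
        then have "h (e x * z) = ennreal (1 + cmod (f (e x * z)) powr p)" for x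
          by (simp add: h_def e_def norm_mult)
        then show "ennreal (cmod (f w)) \<le> ennreal Q * (\<integral>\<^sup>+x\<in>{0..1}. h (e x * z) \<partial>lborel)"
          using norm_Cauchy_circle_le[OF f _ _ z w p] r \<rho> by (simp add: Q_def e_def)
      qed
    qed
    then have "(\<integral>\<^sup>+z. ennreal (cmod (f w)) \<partial>\<mu>) \<le> (\<integral>\<^sup>+z. ennreal Q * (\<integral>\<^sup>+x\<in>{0..1}. h (e x * z) \<partial>lborel) \<partial>\<mu>)"
      by (rule nn_integral_mono_AE)
    also have "\<dots> = ennreal Q * (\<integral>\<^sup>+z. (\<integral>\<^sup>+x\<in>{0..1}. h (e x * z) \<partial>lborel) \<partial>\<mu>)"
      by (rule nn_integral_cmult) measurable
    also have "(\<integral>\<^sup>+z. (\<integral>\<^sup>+x\<in>{0..1}. h (e x * z) \<partial>lborel) \<partial>\<mu>) = (\<integral>\<^sup>+x. (\<integral>\<^sup>+z. h (e x * z) * indicator {0..1} x \<partial>\<mu>) \<partial>lborel)"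
      by (rule Fubini') measurable
    \<comment> \<open>Multiplication by the unimodular \<open>e x\<close> preserves
      \<open>\<mu>\<close>, so the inner integral is the same for every \<open>x\<close>, and the
      interval of angles has length \<open>1\<close>.\<close>
    also have "\<dots> = (\<integral>\<^sup>+x. (\<integral>\<^sup>+z. h z \<partial>\<mu>) * indicator {0..1::real} x \<partial>lborel)"
      by (intro nn_integral_cong) (simp add: nn_integral_multc rot e_def)
    also have "\<dots> = (\<integral>\<^sup>+z. h z \<partial>\<mu>)"
      by (simp add: nn_integral_cmult_indicator)
    also have "\<dots> = (\<integral>\<^sup>+z. G z * h z \<partial>lborel)" by (simp add: nn_\<mu>)
    \<comment> \<open>The annulus is enlarged to the whole disc, where the weight is
      nonnegative.\<close>
    also have "\<dots> \<le> (\<integral>\<^sup>+z. ennreal (\<omega> z) * indicator unit_disc z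
        + ennreal (cmod (f z) powr p * \<omega> z) * indicator unit_disc z \<partial>lborel)"
      by (intro nn_integral_mono)
        (auto simp: G_def h_def indicator_def nonneg ennreal_mult'[symmetric] ennreal_plus[symmetric] algebra_simps simp del: ennreal_plus)
    also have "\<dots> = W' + (\<integral>\<^sup>+z\<in>unit_disc. ennreal (cmod (f z) powr p * \<omega> z) \<partial>lborel)"
    proof -
      have 1: "(\<lambda>z. ennreal (\<omega> z) * indicator unit_disc z) \<in> borel_measurable lebesgue"
        by (intro lebesgue_measurable_of_area borel_measurable_integrable[OF int])
      have 2: "(\<lambda>z. ennreal (cmod (f z) powr p * \<omega> z) * indicator unit_disc z) \<in> borel_measurable lebesgue"
        by (intro lebesgue_measurable_of_area f\<omega>)
      show ?thesis
        using nn_integral_add[OF 1 2] by (simp add: nn_integral_completion W'_def)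
    qed
    also have "(\<integral>\<^sup>+z\<in>unit_disc. ennreal (cmod (f z) powr p * \<omega> z) \<partial>lborel) \<le> ennreal pi"
    proof -
      define I where "I = (\<integral>\<^sup>+z\<in>unit_disc. ennreal (cmod (f z) powr p * \<omega> z) \<partial>lborel)"
      have "bergman_integral p \<omega> f = ennreal (1 / pi) * I"
        unfolding bergman_integral_def I_def
        by (rule nn_integral_area_measure[OF measurable_compose[OF f\<omega> measurable_ennreal]])
      then have "ennreal pi * (ennreal (1 / pi) * I) \<le> ennreal pi * 1"
        using If by (intro mult_left_mono) auto
      moreover have "ennreal pi * (ennreal (1 / pi) * I) = I"
        by (simp add: mult.assoc[symmetric] ennreal_mult'[symmetric])
      ultimately show ?thesis by (simp add: I_def)
    qed
    finally have "ennreal (cmod (f w)) * W \<le> ennreal Q * (W' + ennreal pi)"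
      using em by (simp add: mult_left_mono add_left_mono space\<mu>)
    moreover obtain W0 where W0: "W = ennreal W0" "0 < W0"
      using W_pos W_fin by (cases W) auto
    moreover obtain W1 where W1: "W' = ennreal W1" "0 \<le> W1"
      using W'_fin by (cases W') auto
    ultimately have "cmod (f w) * W0 \<le> Q * (W1 + pi)"
      using Q by (simp add: ennreal_mult'[symmetric] ennreal_plus[symmetric] del: ennreal_plus)
    then show "cmod (f w) \<le> K"
      using W0 W1 by (simp add: K_def field_simps)
  qed
qed

section \<open>Continuity of the semigroup in time\<close>

text \<open>The semigroup law carries continuity at time \<open>0\<close> to time \<open>t\<close>.
  From the right, the limit at \<open>0\<close> is taken at the point \<open>\<phi> t z\<close>.
  From the left, \<open>\<phi> t z\<close> is \<open>\<phi> s\<close> at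
  \<open>\<phi> (t - s) z\<close>, a point close to \<open>z\<close>, and the maps
  \<open>\<phi> s\<close> are equi-Lipschitz near \<open>z\<close>.\<close>

lemma analytic_selfmap_semigroup_continuous:
  assumes \<phi>: "analytic_selfmap_semigroup \<phi>" and t: "0 < t" and z: "z \<in> unit_disc"
  shows "((\<lambda>s. \<phi> s z) \<longlongrightarrow> \<phi> t z) (at t)"
proof -
  have hol: "\<phi> s holomorphic_on unit_disc" and self: "\<And>w. w \<in> unit_disc \<Longrightarrow> \<phi> s w \<in> unit_disc"
    if "0 \<le> s" for s
    using \<phi> that unfolding analytic_selfmap_semigroup_def by (simp, blast)
  have add: "\<phi> (s + s') w = \<phi> s (\<phi> s' w)" if "0 \<le> s" "0 \<le> s'" "w \<in> unit_disc" for s s' w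
    using \<phi> that by (auto simp: analytic_selfmap_semigroup_def)
  have zero: "((\<lambda>s. \<phi> s w) \<longlongrightarrow> w) (at_right 0)" if "w \<in> unit_disc" for w
    using \<phi> that by (auto simp: analytic_selfmap_semigroup_def)
  have "((\<lambda>s. \<phi> s z) \<longlongrightarrow> \<phi> t z) (at_right t)"
  proof -
    have "((\<lambda>s. \<phi> s (\<phi> t z)) \<longlongrightarrow> \<phi> t z) (at_right 0)"
      using t z by (intro zero self) auto
    then have "((\<lambda>s. \<phi> (s + t) z) \<longlongrightarrow> \<phi> t z) (at_right 0)"
      by (rule Lim_transform_eventually)
        (use t z in \<open>auto simp: eventually_at_right_field add intro!: exI[of _ 1]\<close>)
    then show ?thesis by (subst filterlim_at_right_to_0) simp
  qed
  moreover have "((\<lambda>s. \<phi> s z) \<longlongrightarrow> \<phi> t z) (at_left t)"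
  proof -
    \<comment> \<open>For \<open>s\<close> near \<open>t\<close> both \<open>z\<close> and
      \<open>\<phi> (t - s) z\<close> lie within radius \<open>R\<close>. There \<open>L\<close> is
      a Lipschitz constant for every holomorphic map bounded by \<open>1\<close> on the disc, so it
      is independent of \<open>s\<close>.\<close>
    define R where "R = (1 + cmod z) / 2"
    define L where "L = 1 / ((1 - R) / 2)"
    have R: "cmod z < R" "R < 1" using z by (auto simp: R_def)
    have lim: "((\<lambda>s. \<phi> (t - s) z) \<longlongrightarrow> z) (at_left t)"
    proof -
      have "filterlim (\<lambda>s. t - s) (at_right 0) (at_left t)"
        by (auto simp: filterlim_at eventually_at_filter intro!: tendsto_eq_intros)
      then show ?thesis using zero[OF z] by (rule filterlim_compose[rotated])
    qed
    have "((\<lambda>s. L * cmod (z - \<phi> (t - s) z)) \<longlongrightarrow> L * cmod (z - z)) (at_left t)"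
      by (intro tendsto_intros lim)
    then have lim0: "((\<lambda>s. L * cmod (z - \<phi> (t - s) z)) \<longlongrightarrow> 0) (at_left t)" by simp
    have "\<forall>\<^sub>F s in at_left t. cmod (\<phi> (t - s) z) < R"
      using order_tendstoD(2)[OF tendsto_norm[OF lim] R(1)] .
    moreover have "\<forall>\<^sub>F s in at_left t. 0 < s \<and> s < t"
      using t by (auto simp: eventually_at_left_field intro!: exI[of _ 0])
    ultimately have "\<forall>\<^sub>F s in at_left t. norm (\<phi> s z - \<phi> t z) \<le> L * cmod (z - \<phi> (t - s) z)"
    proof eventually_elim
      case (elim s)
      have "\<phi> t z = \<phi> s (\<phi> (t - s) z)" using elim z add[of s "t - s" z] by simp
      moreover have "cmod (\<phi> s z - \<phi> s (\<phi> (t - s) z)) \<le> L * cmod (z - \<phi> (t - s) z)"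
        unfolding L_def
      proof (rule holomorphic_bounded_lipschitz)
        show "\<phi> s holomorphic_on unit_disc" using hol elim by simp
        show "cmod (\<phi> s w) \<le> 1" if "w \<in> unit_disc" for w
          using self[of s w] that elim by simp
      qed (use R elim in auto)
      ultimately show ?case by simp
    qed
    then have "((\<lambda>s. \<phi> s z - \<phi> t z) \<longlongrightarrow> 0) (at_left t)"
      using lim0 by (rule Lim_null_comparison)
    then show ?thesis by (simp add: LIM_zero_iff)
  qed
  ultimately show ?thesis by (simp add: filterlim_split_at)
qed

section \<open>Bergman norms and norm continuity\<close>

lemma bergman_integral_le_1_of_norm:
  assumes p: "0 < p" and le: "bergman_norm p \<omega> f \<le> 1"
  shows "bergman_integral p \<omega> f \<le> 1"
proof (cases "bergman_integral p \<omega> f")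
  case (real I)
  then have "I powr (1 / p) \<le> 1" using le by (simp add: bergman_norm_def)
  then have "(I powr (1 / p)) powr p \<le> 1 powr p" using p by (intro powr_mono2) auto
  then show ?thesis using real p by (cases "I = 0") (auto simp: powr_powr)
next
  case top
  then show ?thesis using le by (simp add: bergman_norm_def)
qed

text \<open>Finiteness of \<open>J\<close> excludes the default value
  \<open>enn2real \<infinity> = 0\<close>, which would make the right-hand side
  \<open>0\<close>.\<close>

lemma bergman_norm_le:
  assumes p: "0 < p" and le: "bergman_integral p \<omega> f \<le> J" and J: "J < \<infinity>"
  shows "bergman_norm p \<omega> f \<le> ennreal (enn2real J powr (1 / p))"
proof -
  have "bergman_integral p \<omega> f < \<infinity>" using le J by order
  moreover have "enn2real (bergman_integral p \<omega> f) \<le> enn2real J"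
    using le J by (intro enn2real_mono) auto
  ultimately show ?thesis
    using p by (auto simp: bergman_norm_def intro!: ennreal_leI powr_mono2)
qed

theorem corollary14:
  fixes p :: real and \<omega> :: "complex \<Rightarrow> real" and \<phi> :: "real \<Rightarrow> complex \<Rightarrow> complex"
  assumes "1 \<le> p"
    and "\<omega> \<in> D_hat"
    and "\<forall>z\<in>unit_disc. 0 < tail_integral \<omega> z"
    and "analytic_selfmap_semigroup \<phi>"
    and "\<exists>t0\<ge>0. Hinf_norm (\<phi> t0) < 1"
  shows "eventually_norm_continuous p \<omega> (composition_semigroup \<phi>)"
proof -
  have p: "1 \<le> p" and rw: "radial_weight \<omega>" using assms unfolding D_hat_def by blast+
  have int: "integrable area_measure \<omega>" and nonneg: "\<And>z. z \<in> unit_disc \<Longrightarrow> 0 \<le> \<omega> z"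
    using rw unfolding radial_weight_def by blast+
  have hol: "\<phi> s holomorphic_on unit_disc" and self: "\<And>w. w \<in> unit_disc \<Longrightarrow> \<phi> s w \<in> unit_disc"
    if "0 \<le> s" for s
    using assms(4) that unfolding analytic_selfmap_semigroup_def by (simp, blast)
  have add: "\<phi> (s + s') w = \<phi> s (\<phi> s' w)" if "0 \<le> s" "0 \<le> s'" "w \<in> unit_disc" for s s' w
    using assms(4) that by (auto simp: analytic_selfmap_semigroup_def)
  obtain t0 where t0: "0 \<le> t0" "Hinf_norm (\<phi> t0) < 1" using assms(5) by auto
  define r where "r = enn2real (Hinf_norm (\<phi> t0))"
  have r_eq: "Hinf_norm (\<phi> t0) = ennreal r" 
    using t0 by (cases "Hinf_norm (\<phi> t0)") (auto simp: r_def)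
  have r: "0 \<le> r" "r < 1" using t0(2) by (simp add: r_def, simp add: r_eq)
  have le_r: "cmod (\<phi> s z) \<le> r" if "t0 \<le> s" "z \<in> unit_disc" for s z
  proof -
    have w: "\<phi> (s - t0) z \<in> unit_disc" using that self by simp
    have "ennreal (cmod (\<phi> t0 (\<phi> (s - t0) z))) \<le> Hinf_norm (\<phi> t0)"
      unfolding Hinf_norm_def using w by (rule SUP_upper)
    then show ?thesis using add[of t0 "s - t0" z] that t0 r by (simp add: r_eq)
  qed
  \<comment> \<open>Two radii are used: functions in the unit ball are bounded by \<open>K\<close>
    up to radius \<open>R\<close>, and the gap \<open>R - r\<close> turns this into a common
    Lipschitz constant \<open>L\<close> on \<open>|w| \<le> r\<close>.\<close>
  define R where "R = (1 + r) / 2"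
  have R: "r < R" "R < 1" "0 \<le> R" using r by (auto simp: R_def)
  obtain K where K: "0 \<le> K" "\<And>f w. f holomorphic_on unit_disc \<Longrightarrow> bergman_integral p \<omega> f \<le> 1 \<Longrightarrow>
      cmod w \<le> R \<Longrightarrow> cmod (f w) \<le> K"
    using bergman_point_bound[OF p rw assms(3) R(3,2)] by blast
  define L where "L = K / ((R - r) / 2)"
  have L: "0 \<le> L" using K R by (simp add: L_def)
  \<comment> \<open>For times from \<open>t0\<close> on, this majorises the Bergman integral of the
    difference of the two composites, simultaneously for all \<open>f\<close> in the unit
    ball.\<close>
  define J where "J = (\<lambda>s t. \<integral>\<^sup>+z. ennreal ((L * cmod (\<phi> s z - \<phi> t z)) powr p * \<omega> z) \<partial>area_measure)"
  have op_le: "bergman_opnorm p \<omega> (\<lambda>f z. composition_semigroup \<phi> s f z - composition_semigroup \<phi> t f z)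
      \<le> ennreal (enn2real (J s t) powr (1 / p))"
    if st: "t0 \<le> s" "t0 \<le> t" and fin: "J s t < \<infinity>" for s t
    unfolding bergman_opnorm_def
  proof (rule SUP_least)
    fix f assume "f \<in> {f \<in> bergman_space p \<omega>. bergman_norm p \<omega> f \<le> 1}"
    then have f: "f holomorphic_on unit_disc" and "bergman_norm p \<omega> f \<le> 1"
      by (auto simp: bergman_space_def)
    then have If: "bergman_integral p \<omega> f \<le> 1" using p by (intro bergman_integral_le_1_of_norm) auto
    have lip: "cmod (f (\<phi> s z) - f (\<phi> t z)) \<le> L * cmod (\<phi> s z - \<phi> t z)" if "z \<in> unit_disc" for z
      unfolding L_def
    proof (rule holomorphic_bounded_lipschitz)
      show "f holomorphic_on ball 0 R" using R by (intro holomorphic_on_subset[OF f]) auto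
      show "cmod (f w) \<le> K" if "w \<in> ball 0 R" for w
        using that by (intro K(2) f If) auto
    qed (use R le_r st that in auto)
    have "bergman_integral p \<omega> (\<lambda>z. composition_semigroup \<phi> s f z - composition_semigroup \<phi> t f z) \<le> J s t"
      unfolding bergman_integral_def J_def composition_semigroup_def comp_def
      using p nonneg lip by (intro nn_integral_mono ennreal_leI mult_right_mono powr_mono2) auto
    then show "bergman_norm p \<omega> (\<lambda>z. composition_semigroup \<phi> s f z - composition_semigroup \<phi> t f z)
      \<le> ennreal (enn2real (J s t) powr (1 / p))"
      using p fin by (intro bergman_norm_le) auto
  qed
  have meas: "(\<lambda>z. (L * cmod (\<phi> s z - \<phi> t z)) powr p * \<omega> z) \<in> borel_measurable area_measure"
    if "0 \<le> s" "0 \<le> t" for s t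
  proof -
    \<comment> \<open>The outer \<open>norm\<close> only fits the shape of
      \<open>continuous_on_norm_powr\<close>; it disappears since \<open>L\<close> is
      nonnegative.\<close>
    have "continuous_on unit_disc (\<lambda>z. norm (L * cmod (\<phi> s z - \<phi> t z)) powr p)"
      using p hol that by (intro continuous_on_norm_powr continuous_intros holomorphic_on_imp_continuous_on) auto
    then show ?thesis
      using L by (intro borel_measurable_times borel_measurable_integrable[OF int] continuous_on_borel_measurable_area)
        simp
  qed
  have J_bound: "ennreal ((L * cmod (\<phi> s z - \<phi> t z)) powr p * \<omega> z) \<le> ennreal ((L * 2) powr p * \<omega> z)"
    if "0 \<le> s" "0 \<le> t" "z \<in> unit_disc" for s t z
  proof -
    have "cmod (\<phi> s z - \<phi> t z) \<le> cmod (\<phi> s z) + cmod (\<phi> t z)" by (rule norm_triangle_ineq4)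
    also have "\<dots> \<le> 2" using self[of s z] self[of t z] that by simp
    finally show ?thesis
      using L p nonneg that by (intro ennreal_leI mult_right_mono powr_mono2 mult_left_mono) auto
  qed
  have dom: "(\<integral>\<^sup>+z. ennreal ((L * 2) powr p * \<omega> z) \<partial>area_measure) < \<infinity>"
  proof -
    have "integrable area_measure (\<lambda>z. (L * 2) powr p * \<omega> z)"
      using int by (rule integrable_mult_right)
    then have "(\<integral>\<^sup>+z. ennreal (norm ((L * 2) powr p * \<omega> z)) \<partial>area_measure) < \<infinity>"
      unfolding integrable_iff_bounded by blast
    also have "(\<integral>\<^sup>+z. ennreal (norm ((L * 2) powr p * \<omega> z)) \<partial>area_measure) =
        (\<integral>\<^sup>+z. ennreal ((L * 2) powr p * \<omega> z) \<partial>area_measure)"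
      using nonneg by (intro nn_integral_cong) (simp add: abs_mult)
    finally show ?thesis .
  qed
  have J_fin: "J s t < \<infinity>" if "0 \<le> s" "0 \<le> t" for s t
  proof -
    have "J s t \<le> (\<integral>\<^sup>+z. ennreal ((L * 2) powr p * \<omega> z) \<partial>area_measure)"
      unfolding J_def using J_bound that by (intro nn_integral_mono) auto
    then show ?thesis using dom by order
  qed
  have J_lim: "((\<lambda>s. J s t) \<longlongrightarrow> 0) (at t within {0..})" if t: "0 < t" for t
    \<comment> \<open>Dominated convergence concerns sequences, so the limit is tested along
      sequences of nonnegative times converging to \<open>t\<close> and avoiding it. The dominating
      function is a constant multiple of the weight.\<close>
    unfolding tendsto_at_iff_sequentially
  proof (intro allI impI)
    fix X assume X: "\<forall>i. X i \<in> {0..} - {t}" "X \<longlonglongrightarrow> t"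
    have "(\<lambda>i. J (X i) t) \<longlonglongrightarrow> (\<integral>\<^sup>+z. 0 \<partial>area_measure)"
      unfolding J_def
    proof (rule nn_integral_dominated_convergence[OF _ _ _ _ dom])
      show "AE z in area_measure. ennreal ((L * cmod (\<phi> (X i) z - \<phi> t z)) powr p * \<omega> z)
          \<le> ennreal ((L * 2) powr p * \<omega> z)" for i
        using X t by (intro AE_I2 J_bound) auto
      show "AE z in area_measure. (\<lambda>i. ennreal ((L * cmod (\<phi> (X i) z - \<phi> t z)) powr p * \<omega> z)) \<longlonglongrightarrow> 0"
      proof (rule AE_I2)
        fix z assume "z \<in> space area_measure"
        then have z: "z \<in> unit_disc" by simp
        have "filterlim X (at t) sequentially"
          using X by (auto simp: filterlim_at)
        then have "(\<lambda>i. \<phi> (X i) z) \<longlonglongrightarrow> \<phi> t z"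
          by (rule filterlim_compose[OF analytic_selfmap_semigroup_continuous[OF assms(4) t z]])
        then have "(\<lambda>i. L * cmod (\<phi> (X i) z - \<phi> t z)) \<longlonglongrightarrow> 0"
          by (auto intro!: tendsto_eq_intros)
        \<comment> \<open>The base tends to \<open>0\<close>, where \<open>powr\<close> is
          continuous only because the base is nonnegative and the exponent positive.\<close>
        then have "(\<lambda>i. (L * cmod (\<phi> (X i) z - \<phi> t z)) powr p) \<longlonglongrightarrow> 0 powr p"
          by (rule tendsto_powr'[OF _ tendsto_const]) (use L p in auto)
        then have "(\<lambda>i. (L * cmod (\<phi> (X i) z - \<phi> t z)) powr p * \<omega> z) \<longlonglongrightarrow> 0 powr p * \<omega> z"
          by (rule tendsto_mult_right)
        then show "(\<lambda>i. ennreal ((L * cmod (\<phi> (X i) z - \<phi> t z)) powr p * \<omega> z)) \<longlonglongrightarrow> 0"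
          using tendsto_ennrealI by force
      qed
    qed (use X t meas int in \<open>auto intro!: measurable_compose[OF _ measurable_ennreal]\<close>)
    then show "((\<lambda>s. J s t) \<circ> X) \<longlonglongrightarrow> 0" by (simp add: comp_def)
  qed
  show ?thesis
    unfolding eventually_norm_continuous_def
  \<comment> \<open>Only \<open>t0 \<ge> 0\<close> is given, while the definition asks for a
    strictly positive time; adding \<open>1\<close> secures this.\<close>
  proof (intro exI[of _ "t0 + 1"] conjI allI impI)
    show "0 < t0 + 1" using t0 by simp
    fix t assume t: "t0 + 1 < t"
    have "((\<lambda>s. enn2real (J s t)) \<longlongrightarrow> enn2real 0) (at t within {0..})"
      using J_lim t t0 by (intro tendsto_enn2real) auto
    then have "((\<lambda>s. enn2real (J s t) powr (1 / p)) \<longlongrightarrow> 0 powr (1 / p)) (at t within {0..})"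
      using p by (intro tendsto_powr') auto
    then have lim: "((\<lambda>s. ennreal (enn2real (J s t) powr (1 / p))) \<longlongrightarrow> 0) (at t within {0..})"
      using tendsto_ennrealI by force
    have "\<forall>\<^sub>F s in at t within {0..}. t0 < s"
      using t by (intro order_tendstoD(1)[OF tendsto_ident_at]) auto
    then have "\<forall>\<^sub>F s in at t within {0..}.
      bergman_opnorm p \<omega> (\<lambda>f z. composition_semigroup \<phi> s f z - composition_semigroup \<phi> t f z)
        \<le> ennreal (enn2real (J s t) powr (1 / p))"
      by eventually_elim (use t t0 J_fin op_le in auto)
    then show "((\<lambda>s. bergman_opnorm p \<omega> (\<lambda>f z. composition_semigroup \<phi> s f z - composition_semigroup \<phi> t f z))
        \<longlongrightarrow> 0) (at t within {0..})"
      by (intro tendsto_sandwich[OF _ _ tendsto_const lim]) auto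
  qed
qed

end
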